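(* Let $F=(f_1,\dots,f_{n-1},f_n=H):M\to\mathbb{R}^n$ be a proper completely integrable system on a symplectic manifold $M$ of dimension $2n$, let $\Lambda$ be a Liouville torus of $F$, and let $I=(I_1,\dots,I_n)$ be a set of oriented action variables near $\Lambda$. If $I'=(I'_1,\dots,I'_n)$ is another set of oriented action variables near $\Lambda$, then there is a matrix $A\in\mathrm{SL}(n,\mathbb{Z})$ such that $$dI = A\, dI',$$ and the rotation number relative to $I'$ is $$[w_{I'}] = {}^tA\circ[w_I],$$ where $\circ$ denotes the natural action of $\mathrm{SL}(n,\mathbb{Z})$ on $\mathbb{RP}^{n-1}$. When $n=2$, if instead one writes the rotation number as the quotient $w_I=\partial_1 g(I)/\partial_2 g(I)\in\overline{\mathbb{R}}$, then $w_{I'}$ is obtained by the Möbius transformation $$w_{I'}=\frac{a\,w_I+c}{b\,w_I+d},\qquad\text{where } A=\begin{pmatrix}a&b\\c&d\end{pmatrix}.$$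
   Context: Completely integrable system: smooth functions $f_1,\dots,f_{n-1},f_n=H$ on $M$ with $\{f_j,f_k\}=0$ for all $j,k$ and with differentials almost everywhere linearly independent; $F=(f_1,\dots,f_n)$ is assumed proper. A Liouville torus $\Lambda$ is a connected component of $F^{-1}(c)$ for a regular value $c$ of $F$. By the action-angle theorem, near $\Lambda$ there are symplectic coordinates $(I,\theta)\in\mathbb{R}^n\times\mathbb{T}^n$ (with $\mathbb T^n=(\mathbb R/2\pi\mathbb Z)^n$ and symplectic form $\sum_j dI_j\wedge d\theta_j$), such that $F=G(I)$ for a local diffeomorphism $G$ of $\mathbb{R}^n$; $I=(I_1,\dots,I_n)$ are called action variables near $\Lambda$, and they are oriented if $\det dG>0$. In particular $H=g(I_1,\dots,I_n)$ for a smooth function $g$ whose differential does not vanish. The rotation number of $H$ relative to $I$ on a Liouville torus $\Lambda$ is $[w_I](\Lambda)=[\partial_1 g(I(\Lambda)):\cdots:\partial_n g(I(\Lambda))]\in\mathbb{RP}^{n-1}$. Elements of $\mathbb{RP}^{n-1}$ are viewed as classes of vectors of $\mathbb{R}^n$; $\overline{\mathbb{R}}=\mathbb{R}\cup\{\infty\}$ is the one-point compactification, identified with $\mathbb{RP}^1$ via $z\mapsto[z:1]$ for $z\in\mathbb R$ and $\infty\mapsto[1:0]$. $dI$ denotes the column vector of differentials $(dI_1,\dots,dI_n)$. *)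

theory Defs
  imports "HOL-Analysis.Analysis"
begin

section \<open>Smooth maps between Euclidean spaces\<close>

text \<open>These notions are meant for open sets \<open>S\<close>.\<close>

fun Ck_on :: "nat \<Rightarrow> 'a::real_normed_vector set \<Rightarrow> ('a \<Rightarrow> 'b::real_normed_vector) \<Rightarrow> bool" where
  "Ck_on 0 S f \<longleftrightarrow> continuous_on S f"
| "Ck_on (Suc k) S f \<longleftrightarrow>
     (\<forall>x\<in>S. f differentiable (at x)) \<and> (\<forall>v. Ck_on k S (\<lambda>x. frechet_derivative f (at x) v))"

definition smooth_on :: "'a::real_normed_vector set \<Rightarrow> ('a \<Rightarrow> 'b::real_normed_vector) \<Rightarrow> bool" where
  "smooth_on S f \<longleftrightarrow> (\<forall>k. Ck_on k S f)"

definition local_diffeo_on :: "'a::real_normed_vector set \<Rightarrow> ('a \<Rightarrow> 'b::real_normed_vector) \<Rightarrow> bool" where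
  "local_diffeo_on V G \<longleftrightarrow>
     (\<forall>x\<in>V. \<exists>X Y K. open X \<and> x \<in> X \<and> X \<subseteq> V \<and> open Y \<and>
        homeomorphism X Y G K \<and> smooth_on X G \<and> smooth_on Y K)"

section \<open>Smooth manifolds\<close>

text \<open>The manifold is the whole (Hausdorff, second countable) type \<open>'m\<close>, with an atlas modelled
  on the Euclidean space \<open>'e\<close>; its dimension is \<open>DIM('e)\<close>. A chart is a pair of its domain and its
  coordinate map.\<close>

type_synonym ('m, 'e) chart = "'m set \<times> ('m \<Rightarrow> 'e)"

definition chart_inv :: "('m, 'e) chart \<Rightarrow> 'e \<Rightarrow> 'm" where
  "chart_inv c = inv_into (fst c) (snd c)"

definition is_chart :: "('m::topological_space, 'e::euclidean_space) chart \<Rightarrow> bool" where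
  "is_chart c \<longleftrightarrow> open (fst c) \<and> open (snd c ` fst c) \<and>
     homeomorphism (fst c) (snd c ` fst c) (snd c) (chart_inv c)"

definition compatible ::
    "('m, 'e::euclidean_space) chart \<Rightarrow> ('m, 'd::euclidean_space) chart \<Rightarrow> bool" where
  "compatible c d \<longleftrightarrow>
     smooth_on (snd c ` (fst c \<inter> fst d)) (snd d \<circ> chart_inv c) \<and>
     smooth_on (snd d ` (fst c \<inter> fst d)) (snd c \<circ> chart_inv d)"

definition smooth_manifold ::
    "('m::{t2_space,second_countable_topology}, 'e::euclidean_space) chart set \<Rightarrow> bool" where
  "smooth_manifold \<A> \<longleftrightarrow>
     (\<forall>c\<in>\<A>. is_chart c) \<and> (\<Union>c\<in>\<A>. fst c) = UNIV \<and> (\<forall>c\<in>\<A>. \<forall>d\<in>\<A>. compatible c d)"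

definition smooth_map ::
    "('m, 'e::euclidean_space) chart set \<Rightarrow> ('m \<Rightarrow> 'b::real_normed_vector) \<Rightarrow> bool" where
  "smooth_map \<A> f \<longleftrightarrow> (\<forall>c\<in>\<A>. smooth_on (snd c ` fst c) (f \<circ> chart_inv c))"

text \<open>The differential of \<open>f\<close> at \<open>p\<close>; tangent vectors at \<open>p\<close> are represented by their components
  in the chart \<open>c\<close>, which has to contain \<open>p\<close>.\<close>

definition differential ::
    "('m, 'e::euclidean_space) chart \<Rightarrow> ('m \<Rightarrow> 'b::real_normed_vector) \<Rightarrow> 'm \<Rightarrow> 'e \<Rightarrow> 'b" where
  "differential c f p = frechet_derivative (f \<circ> chart_inv c) (at (snd c p))"

section \<open>Symplectic manifolds\<close>

text \<open>A two-form is given by its local representatives: \<open>\<omega> c p u v\<close> is its value at \<open>p\<close> on the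
  tangent vectors whose components in the chart \<open>c\<close> are \<open>u\<close> and \<open>v\<close>.\<close>

type_synonym ('m, 'e) two_form = "('m, 'e) chart \<Rightarrow> 'm \<Rightarrow> 'e \<Rightarrow> 'e \<Rightarrow> real"

definition smooth_two_form ::
    "('m, 'e::euclidean_space) chart set \<Rightarrow> ('m, 'e) two_form \<Rightarrow> bool" where
  "smooth_two_form \<A> \<omega> \<longleftrightarrow>
     (\<forall>c\<in>\<A>. \<forall>p\<in>fst c. bilinear (\<omega> c p) \<and> (\<forall>u. \<omega> c p u u = 0)) \<and>
     (\<forall>c\<in>\<A>. \<forall>u v. smooth_on (snd c ` fst c) (\<lambda>x. \<omega> c (chart_inv c x) u v)) \<and>
     (\<forall>c\<in>\<A>. \<forall>d\<in>\<A>. \<forall>p \<in> fst c \<inter> fst d. \<forall>u v.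
        \<omega> c p u v = \<omega> d p (differential c (snd d) p u) (differential c (snd d) p v))"

text \<open>On constant vector fields \<open>u\<close>, \<open>v\<close>, \<open>w\<close> of a chart, \<open>d\<omega> (u, v, w)\<close> is the cyclic sum of the
  directional derivatives, since the Lie brackets vanish.\<close>

definition closed_two_form ::
    "('m, 'e::euclidean_space) chart set \<Rightarrow> ('m, 'e) two_form \<Rightarrow> bool" where
  "closed_two_form \<A> \<omega> \<longleftrightarrow> (\<forall>c\<in>\<A>. \<forall>p\<in>fst c. \<forall>u v w.
     differential c (\<lambda>q. \<omega> c q v w) p u +
     differential c (\<lambda>q. \<omega> c q w u) p v +
     differential c (\<lambda>q. \<omega> c q u v) p w = 0)"

definition nondegenerate_two_form ::
    "('m, 'e::euclidean_space) chart set \<Rightarrow> ('m, 'e) two_form \<Rightarrow> bool" where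
  "nondegenerate_two_form \<A> \<omega> \<longleftrightarrow>
     (\<forall>c\<in>\<A>. \<forall>p\<in>fst c. \<forall>u. (\<forall>v. \<omega> c p u v = 0) \<longrightarrow> u = 0)"

definition symplectic_manifold ::
    "('m::{t2_space,second_countable_topology}, 'e::euclidean_space) chart set
      \<Rightarrow> ('m, 'e) two_form \<Rightarrow> bool" where
  "symplectic_manifold \<A> \<omega> \<longleftrightarrow> smooth_manifold \<A> \<and> smooth_two_form \<A> \<omega> \<and>
     closed_two_form \<A> \<omega> \<and> nondegenerate_two_form \<A> \<omega>"

text \<open>The opposite sign convention for Hamiltonian vector fields yields the same Poisson bracket.\<close>

definition hamiltonian_field ::
    "('m, 'e::euclidean_space) two_form \<Rightarrow> ('m, 'e) chart \<Rightarrow> ('m \<Rightarrow> real) \<Rightarrow> 'm \<Rightarrow> 'e" where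
  "hamiltonian_field \<omega> c f p = (THE X. \<forall>v. \<omega> c p X v = differential c f p v)"

definition poisson_bracket ::
    "('m, 'e::euclidean_space) two_form \<Rightarrow> ('m, 'e) chart
      \<Rightarrow> ('m \<Rightarrow> real) \<Rightarrow> ('m \<Rightarrow> real) \<Rightarrow> 'm \<Rightarrow> real" where
  "poisson_bracket \<omega> c f k p = \<omega> c p (hamiltonian_field \<omega> c f p) (hamiltonian_field \<omega> c k p)"

section \<open>Completely integrable systems and Liouville tori\<close>

definition regular_point ::
    "('m, 'e::euclidean_space) chart set \<Rightarrow> ('m \<Rightarrow> real^'n) \<Rightarrow> 'm \<Rightarrow> bool" where
  "regular_point \<A> F p \<longleftrightarrow> (\<forall>c\<in>\<A>. p \<in> fst c \<longrightarrow>
     (\<forall>a::real^'n. (\<forall>v. (\<Sum>j\<in>UNIV. a $ j * differential c (\<lambda>q. F q $ j) p v) = 0) \<longrightarrow> a = 0))"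

definition completely_integrable ::
    "('m, 'e::euclidean_space) chart set \<Rightarrow> ('m, 'e) two_form \<Rightarrow> ('m \<Rightarrow> real^'n) \<Rightarrow> bool" where
  "completely_integrable \<A> \<omega> F \<longleftrightarrow>
     (\<forall>j. smooth_map \<A> (\<lambda>p. F p $ j)) \<and>
     (\<forall>j k. \<forall>c\<in>\<A>. \<forall>p\<in>fst c. poisson_bracket \<omega> c (\<lambda>q. F q $ j) (\<lambda>q. F q $ k) p = 0) \<and>
     (\<forall>c\<in>\<A>. negligible (snd c ` {p \<in> fst c. \<not> regular_point \<A> F p}))"

definition regular_value ::
    "('m, 'e::euclidean_space) chart set \<Rightarrow> ('m \<Rightarrow> real^'n) \<Rightarrow> real^'n \<Rightarrow> bool" where
  "regular_value \<A> F y \<longleftrightarrow> (\<forall>p. F p = y \<longrightarrow> regular_point \<A> F p)"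

definition liouville_torus ::
    "('m::topological_space, 'e::euclidean_space) chart set \<Rightarrow> ('m \<Rightarrow> real^'n) \<Rightarrow> 'm set \<Rightarrow> bool" where
  "liouville_torus \<A> F \<Lambda> \<longleftrightarrow> (\<exists>y. regular_value \<A> F y \<and> \<Lambda> \<in> components (F -` {y}))"

section \<open>Action-angle coordinates\<close>

text \<open>The form \<open>\<Sum>j. dI\<^sub>j \<and> d\<theta>\<^sub>j\<close> on pairs \<open>(I, \<theta>)\<close>.\<close>

definition std_symplectic :: "(real^'n) \<times> (real^'n) \<Rightarrow> (real^'n) \<times> (real^'n) \<Rightarrow> real" where
  "std_symplectic u v = fst u \<bullet> snd v - fst v \<bullet> snd u"

definition symplectic_coordinates ::
    "('m::topological_space, 'e::euclidean_space) chart set \<Rightarrow> ('m, 'e) two_form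
      \<Rightarrow> ('m, (real^'n) \<times> (real^'n)) chart \<Rightarrow> bool" where
  "symplectic_coordinates \<A> \<omega> d \<longleftrightarrow>
     is_chart d \<and> (\<forall>c\<in>\<A>. compatible c d) \<and>
     (\<forall>c\<in>\<A>. \<forall>p \<in> fst c \<inter> fst d. \<forall>u v.
        \<omega> c p u v = std_symplectic (differential c (snd d) p u) (differential c (snd d) p v))"

text \<open>Elements of the torus \<open>(\<real>/2\<pi>\<int>)\<^sup>n\<close> are represented by vectors of angles modulo \<open>2\<pi>\<close>.\<close>

definition angle_eq :: "real^'n \<Rightarrow> real^'n \<Rightarrow> bool" where
  "angle_eq s t \<longleftrightarrow> (\<forall>j. \<exists>k::int. s $ j - t $ j = 2 * pi * of_int k)"

text \<open>\<open>(I, \<theta> mod 2\<pi>)\<close> is a symplectic diffeomorphism from \<open>U\<close> onto \<open>V \<times> (\<real>/2\<pi>\<int>)\<^sup>n\<close>: it is bijective,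
  and a local diffeomorphism preserving the symplectic forms. The latter is expressed with local
  real-valued lifts \<open>\<phi>\<close> of \<open>\<theta>\<close>, which amounts to using the standard charts of the torus; \<open>\<theta>\<close>
  itself need not be continuous as a map to \<open>real^'n\<close>.\<close>

definition action_angle_coordinates ::
    "('m::topological_space, 'e::euclidean_space) chart set \<Rightarrow> ('m, 'e) two_form
      \<Rightarrow> 'm set \<Rightarrow> (real^'n) set \<Rightarrow> ('m \<Rightarrow> real^'n) \<Rightarrow> ('m \<Rightarrow> real^'n) \<Rightarrow> bool" where
  "action_angle_coordinates \<A> \<omega> U V I \<theta> \<longleftrightarrow>
     open U \<and> open V \<and> I ` U \<subseteq> V \<and>
     (\<forall>x\<in>V. \<forall>t. \<exists>!p. p \<in> U \<and> I p = x \<and> angle_eq (\<theta> p) t) \<and>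
     (\<forall>p\<in>U. \<exists>W \<phi>. p \<in> W \<and> W \<subseteq> U \<and> (\<forall>q\<in>W. angle_eq (\<phi> q) (\<theta> q)) \<and>
        symplectic_coordinates \<A> \<omega> (W, \<lambda>q. (I q, \<phi> q)))"

text \<open>Near \<open>\<Lambda>\<close> means on the neighbourhood \<open>U\<close> of \<open>\<Lambda>\<close>.\<close>

definition oriented_action_variables ::
    "('m::topological_space, 'e::euclidean_space) chart set \<Rightarrow> ('m, 'e) two_form
      \<Rightarrow> ('m \<Rightarrow> real^'n) \<Rightarrow> 'm set \<Rightarrow> 'm set \<Rightarrow> ('m \<Rightarrow> real^'n) \<Rightarrow> bool" where
  "oriented_action_variables \<A> \<omega> F \<Lambda> U I \<longleftrightarrow> \<Lambda> \<subseteq> U \<and>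
     (\<exists>V \<theta> G. action_angle_coordinates \<A> \<omega> U V I \<theta> \<and>
        local_diffeo_on V G \<and> (\<forall>p\<in>U. F p = G (I p)) \<and>
        (\<forall>x\<in>V. det (jacobian G (at x)) > 0))"

section \<open>Projective space and rotation numbers\<close>

text \<open>A point of projective space is the class of the nonzero multiples of a nonzero vector.\<close>

definition proj_class :: "real^'n \<Rightarrow> (real^'n) set" where
  "proj_class v = {r *\<^sub>R v | r. r \<noteq> 0}"

definition real_projective_space :: "(real^'n) set set" where
  "real_projective_space = {proj_class v | v. v \<noteq> 0}"

definition SL_int :: "(int^'n^'n) set" where
  "SL_int = {A. det A = 1}"

abbreviation real_matrix :: "int^'n^'m \<Rightarrow> real^'n^'m" where
  "real_matrix \<equiv> map_matrix of_int"

definition proj_action :: "int^'n^'n \<Rightarrow> (real^'n) set \<Rightarrow> (real^'n) set" where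
  "proj_action A L = (\<lambda>v. real_matrix A *v v) ` L"

text \<open>For \<open>H = g (I)\<close>, the vector of partial derivatives of \<open>g\<close> at \<open>I(\<Lambda>)\<close>, which is a single
  point of \<open>real^'n\<close> for a Liouville torus \<open>\<Lambda>\<close>.\<close>

definition rotation_vector ::
    "(real^'n \<Rightarrow> real) \<Rightarrow> ('m \<Rightarrow> real^'n) \<Rightarrow> 'm set \<Rightarrow> real^'n" where
  "rotation_vector g I \<Lambda> = (\<chi> j. frechet_derivative g (at (the_elem (I ` \<Lambda>))) (axis j 1))"

definition rotation_number ::
    "(real^'n \<Rightarrow> real) \<Rightarrow> ('m \<Rightarrow> real^'n) \<Rightarrow> 'm set \<Rightarrow> (real^'n) set" where
  "rotation_number g I \<Lambda> = proj_class (rotation_vector g I \<Lambda>)"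

text \<open>The one-point compactification of the real line; the quotient \<open>x / y\<close> is the point identified
  with \<open>[x : y]\<close>, so that \<open>x / 0\<close> is the point at infinity.\<close>

datatype rbar = Finite_Point real | Infinity_Point

definition rbar_quotient :: "real \<Rightarrow> real \<Rightarrow> rbar" where
  "rbar_quotient x y = (if y = 0 then Infinity_Point else Finite_Point (x / y))"

text \<open>The extension of \<open>z \<mapsto> (p z + q) / (r z + s)\<close>.\<close>

fun moebius_rbar :: "real \<Rightarrow> real \<Rightarrow> real \<Rightarrow> real \<Rightarrow> rbar \<Rightarrow> rbar" where
  "moebius_rbar p q r s (Finite_Point z) = rbar_quotient (p * z + q) (r * z + s)"
| "moebius_rbar p q r s Infinity_Point = rbar_quotient p r"

text \<open>For \<open>n = 2\<close>, with \<open>i\<close> the first and \<open>k\<close> the second index.\<close>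

definition rotation_quotient ::
    "'n \<Rightarrow> 'n \<Rightarrow> (real^'n \<Rightarrow> real) \<Rightarrow> ('m \<Rightarrow> real^'n) \<Rightarrow> 'm set \<Rightarrow> rbar" where
  "rotation_quotient i k g I \<Lambda> =
     rbar_quotient (rotation_vector g I \<Lambda> $ i) (rotation_vector g I \<Lambda> $ k)"

end

theory Submission
  imports Defs
begin

text \<open>Let \<open>F = G(I) = G'(I')\<close>. Differentiating gives \<open>DG(I) dI = dF = DG'(I') dI'\<close>, so pointwise
  \<open>dI = M dI'\<close> for the matrix \<open>M = DG(I)\<^sup>-\<^sup>1 DG'(I')\<close>, which is continuous and has positive
  determinant. The content of the theorem is that \<open>M\<close> is integral, of determinant one and constant.

  Integrality comes from the periods of the tori. On a torus \<open>I = x\<close> that lies in the domain of both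
  coordinate systems, \<open>I'\<close> and hence \<open>M\<close> are constant: the torus is connected, \<open>F\<close> is constant on it,
  and \<open>G'\<close> is locally injective. Both coordinate systems are symplectic, so translating the angles \<open>\<theta>\<close>
  by \<open>e\<close> translates \<open>\<theta>'\<close> by the transpose of \<open>M\<close> applied to \<open>e\<close> (\<open>symplectic_transpose\<close>,
  \<open>angle_along_torus\<close>). A full turn of one angle returns to the same point, so the rows of \<open>M\<close> are
  integral (\<open>transition_matrix_integral\<close>).

  The Liouville torus \<open>\<Lambda>\<close>, being a component of a level set of \<open>F\<close>, is a complete fibre of \<open>I\<close> and of
  \<open>I'\<close> (\<open>liouville_torus_is_fibre\<close>). The two systems can therefore be exchanged on it; the inverse of
  \<open>M\<close> is integral too, and positivity gives determinant one. The tori of \<open>I\<close> near \<open>\<Lambda>\<close> lie in the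
  common domain by compactness of the torus (\<open>fibre_neighbourhood\<close>), and they form a connected
  set on which the continuous integral matrix \<open>M\<close> is a constant \<open>A\<close>.

  Finally, the gradient of \<open>g\<close> at \<open>I(\<Lambda>)\<close> is the row of \<open>DG\<close> belonging to \<open>H\<close>, and similarly for \<open>g'\<close>. The
  corresponding row of \<open>DG M = DG'\<close> is the transformation of the rotation numbers.\<close>

section \<open>Differential calculus in charts\<close>

lemma is_chartD:
  assumes "is_chart c"
  shows "open (fst c)" "open (snd c ` fst c)"
    "continuous_on (fst c) (snd c)" "continuous_on (snd c ` fst c) (chart_inv c)"
    "\<And>p. p \<in> fst c \<Longrightarrow> chart_inv c (snd c p) = p"
    "\<And>y. y \<in> snd c ` fst c \<Longrightarrow> snd c (chart_inv c y) = y"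
    "\<And>y. y \<in> snd c ` fst c \<Longrightarrow> chart_inv c y \<in> fst c"
proof -
  have h: "homeomorphism (fst c) (snd c ` fst c) (snd c) (chart_inv c)"
    using assms by (simp add: is_chart_def)
  show "open (fst c)" "open (snd c ` fst c)"
    using assms by (simp_all add: is_chart_def)
  show "continuous_on (fst c) (snd c)" "continuous_on (snd c ` fst c) (chart_inv c)"
    using h by (simp_all add: homeomorphism_def)
  show "\<And>p. p \<in> fst c \<Longrightarrow> chart_inv c (snd c p) = p"
    by (rule homeomorphism_apply1[OF h])
  show "\<And>y. y \<in> snd c ` fst c \<Longrightarrow> snd c (chart_inv c y) = y"
    by (rule homeomorphism_apply2[OF h])
  show "\<And>y. y \<in> snd c ` fst c \<Longrightarrow> chart_inv c y \<in> fst c"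
    using homeomorphism_image2[OF h] by blast
qed

lemma open_chart_image:
  assumes "is_chart c" "open S" "S \<subseteq> fst c"
  shows "open (snd c ` S)"
proof -
  have "homeomorphism (fst c) (snd c ` fst c) (snd c) (chart_inv c)"
    using assms(1) by (simp add: is_chart_def)
  moreover have "openin (top_of_set (fst c)) S"
    using assms is_chartD(1)[OF assms(1)] by (simp add: openin_open_eq)
  ultimately have "openin (top_of_set (snd c ` fst c)) (snd c ` S)"
    by (rule homeomorphism_imp_open_map)
  then show ?thesis
    using is_chartD(2)[OF assms(1)] by (rule openin_open_trans)
qed

lemma smooth_on_differentiable:
  assumes "smooth_on S f" "x \<in> S"
  shows "f differentiable (at x)"
proof -
  have "Ck_on (Suc 0) S f"
    using assms(1) unfolding smooth_on_def by (rule spec)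
  then show ?thesis
    using assms(2) by simp
qed

lemma smooth_on_continuous_frechet_derivative:
  assumes "smooth_on S f"
  shows "continuous_on S (\<lambda>x. frechet_derivative f (at x) v)"
proof -
  have "Ck_on (Suc 0) S f"
    using assms(1) unfolding smooth_on_def by (rule spec)
  then show ?thesis
    by simp
qed

lemma has_derivative_in_chart:
  assumes "f \<circ> chart_inv c differentiable (at (snd c p))"
  shows "((f \<circ> chart_inv c) has_derivative differential c f p) (at (snd c p))"
  using assms by (simp add: differential_def frechet_derivative_works)

lemma differential_eqI:
  assumes "((f \<circ> chart_inv c) has_derivative D) (at (snd c p))"
  shows "differential c f p = D"
  unfolding differential_def by (rule frechet_derivative_at[OF assms, symmetric])

lemma has_derivative_transition:
  assumes "compatible c d" "p \<in> fst c \<inter> fst d"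
  shows "((snd d \<circ> chart_inv c) has_derivative differential c (snd d) p) (at (snd c p))"
proof (rule has_derivative_in_chart)
  have "smooth_on (snd c ` (fst c \<inter> fst d)) (snd d \<circ> chart_inv c)"
    using assms(1) by (simp add: compatible_def)
  then show "snd d \<circ> chart_inv c differentiable (at (snd c p))"
    using assms(2) by (blast intro: smooth_on_differentiable)
qed

lemma compatible_sym: "compatible c d \<Longrightarrow> compatible d c"
  by (simp add: compatible_def Int_commute)

text \<open>The domains of \<open>c\<close> and \<open>d\<close> may live over different model spaces; this is the chain rule for
  \<open>f \<circ> chart_inv c = (f \<circ> chart_inv d) \<circ> (snd d \<circ> chart_inv c)\<close>, an identity that holds
  only on the image of the overlap.\<close>

lemma has_derivative_change_chart:
  assumes c: "is_chart c" and d: "is_chart d" and cd: "compatible c d" and p: "p \<in> fst c \<inter> fst d"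
    and f: "((f \<circ> chart_inv d) has_derivative D) (at (snd d p))"
  shows "((f \<circ> chart_inv c) has_derivative D \<circ> differential c (snd d) p) (at (snd c p))"
proof -
  have "((f \<circ> chart_inv d) has_derivative D) (at ((snd d \<circ> chart_inv c) (snd c p)))"
    using f p is_chartD(5)[OF c] by simp
  then have "((f \<circ> chart_inv d) \<circ> (snd d \<circ> chart_inv c) has_derivative
      D \<circ> differential c (snd d) p) (at (snd c p))"
    by (intro diff_chain_at has_derivative_transition[OF cd p])
  moreover have "open (snd c ` (fst c \<inter> fst d))"
    using c d by (intro open_chart_image) (auto simp: is_chartD)
  moreover have "snd c p \<in> snd c ` (fst c \<inter> fst d)"
    using p by blast
  ultimately show ?thesis
    by (rule has_derivative_transform_within_open) (auto simp: is_chartD[OF c] is_chartD[OF d])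
qed

lemma differential_transition_inverse:
  assumes c: "is_chart c" and d: "is_chart d" and cd: "compatible c d" and p: "p \<in> fst c \<inter> fst d"
  shows "differential c (snd d) p (differential d (snd c) p v) = v"
proof -
  have "((snd d \<circ> chart_inv d) has_derivative
      differential c (snd d) p \<circ> differential d (snd c) p) (at (snd d p))"
    using has_derivative_transition[OF cd p] p
    by (intro has_derivative_change_chart[OF d c compatible_sym[OF cd]]) auto
  moreover have "((snd d \<circ> chart_inv d) has_derivative (\<lambda>x. x)) (at (snd d p))"
    by (rule has_derivative_transform_within_open[OF has_derivative_ident is_chartD(2)[OF d]])
      (use p in \<open>auto simp: is_chartD[OF d]\<close>)
  ultimately show ?thesis
    by (metis comp_apply has_derivative_unique)
qed

section \<open>Linear algebra\<close>

text \<open>Pairing \<open>u\<close> with arbitrary \<open>v\<close> determines \<open>snd (D' u)\<close>, since \<open>fst (D' v)\<close> takes all values.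
  This is why angles transform by the transpose of the matrix transforming the actions.\<close>

lemma symplectic_transpose:
  fixes D D' :: "'e \<Rightarrow> (real^'n) \<times> (real^'n)" and M :: "real^'n^'n"
  assumes symp: "\<And>v. std_symplectic (D u) (D v) = std_symplectic (D' u) (D' v)"
    and fst_eq: "\<And>v. fst (D v) = M *v fst (D' v)"
    and surj: "surj D'" and M: "invertible M" and u: "fst (D u) = 0"
  shows "fst (D' u) = 0 \<and> snd (D' u) = transpose M *v snd (D u)"
proof
  show fst_u: "fst (D' u) = 0"
    using fst_eq[of u] u inj_matrix_vector_mult[OF M] by (metis injD matrix_vector_mult_0_right)
  have "w \<bullet> snd (D' u) = w \<bullet> (transpose M *v snd (D u))" for w
  proof -
    obtain v where v: "D' v = (w, 0)"
      using surj by (metis surjD)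
    have "fst (D v) \<bullet> snd (D u) = fst (D' v) \<bullet> snd (D' u)"
      using symp[of v] u fst_u by (simp add: std_symplectic_def)
    then show ?thesis
      using fst_eq[of v] v by (metis dot_lmul_matrix fst_conv inner_commute transpose_matrix_vector)
  qed
  then show "snd (D' u) = transpose M *v snd (D u)"
    using vector_eq_ldot by blast
qed

lemma continuous_on_matrix_entries:
  fixes A :: "'a::topological_space \<Rightarrow> real^'n^'m"
  assumes "\<And>i j. continuous_on S (\<lambda>x. A x $ i $ j)"
  shows "continuous_on S A"
proof -
  have "continuous_on S (\<lambda>x. \<chi> i j. A x $ i $ j)"
    by (intro continuous_on_vec_lambda assms)
  then show ?thesis
    by simp
qed

lemma continuous_on_det:
  fixes A :: "'a::topological_space \<Rightarrow> real^'n^'n"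
  assumes "continuous_on S A"
  shows "continuous_on S (\<lambda>x. det (A x))"
  unfolding det_def by (intro continuous_intros assms)

lemma invertible_inverse_mult:
  fixes A :: "real^'n^'n"
  assumes "invertible A"
  shows "A ** matrix_inv A = mat 1" and "matrix_inv A ** A = mat 1"
proof -
  have "\<exists>B. A ** B = mat 1 \<and> B ** A = mat 1"
    using assms unfolding invertible_def .
  from someI_ex[OF this] show "A ** matrix_inv A = mat 1" and "matrix_inv A ** A = mat 1"
    unfolding matrix_inv_def by blast+
qed

text \<open>Cramer's rule makes the solution \<open>X\<close> of \<open>A ** X = B\<close> a quotient of polynomials in the
  entries.\<close>

lemma continuous_on_matrix_left_division:
  fixes A B :: "'a::topological_space \<Rightarrow> real^'n^'n"
  assumes A: "continuous_on S A" and B: "continuous_on S B" and det: "\<And>x. x \<in> S \<Longrightarrow> det (A x) \<noteq> 0"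
  shows "continuous_on S (\<lambda>x. (matrix_inv (A x) ** B x) $ i $ j)"
proof -
  have "(matrix_inv (A x) ** B x) $ i $ j =
      det (\<chi> k l. if l = i then B x $ k $ j else A x $ k $ l) / det (A x)" if "x \<in> S" for x
  proof -
    have "A x ** (matrix_inv (A x) ** B x) = B x"
      using det[OF that] by (simp add: matrix_mul_assoc invertible_inverse_mult invertible_det_nz)
    then have "A x *v column j (matrix_inv (A x) ** B x) = column j (B x)"
      by (metis matrix_vector_mul_assoc matrix_vector_mult_basis)
    then have "column j (matrix_inv (A x) ** B x) =
        (\<chi> m. det (\<chi> k l. if l = m then column j (B x) $ k else A x $ k $ l) / det (A x))"
      by (simp only: cramer[OF det[OF that]])
    then have "column j (matrix_inv (A x) ** B x) $ i =
        det (\<chi> k l. if l = i then column j (B x) $ k else A x $ k $ l) / det (A x)"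
      by simp
    then show ?thesis
      by (simp add: column_def cong: if_cong)
  qed
  moreover have "continuous_on S (\<lambda>x. \<chi> k l. if l = i then B x $ k $ j else A x $ k $ l)"
  proof (intro continuous_on_matrix_entries)
    fix k l
    have "continuous_on S (\<lambda>x. B x $ k $ j)" "continuous_on S (\<lambda>x. A x $ k $ l)"
      by (intro continuous_intros A B)+
    then show "continuous_on S
        (\<lambda>x. (\<chi> k l. if l = i then B x $ k $ j else A x $ k $ l) $ k $ l)"
      by (cases "l = i") simp_all
  qed
  then have "continuous_on S (\<lambda>x.
      det (\<chi> k l. if l = i then B x $ k $ j else A x $ k $ l) / det (A x))"
    by (intro continuous_on_divide continuous_on_det A) (use det in auto)
  ultimately show ?thesis
    by (simp cong: continuous_on_cong)
qed

lemma integral_real_matrix: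
  fixes M :: "real^'n^'n"
  assumes "\<And>i j. M $ i $ j \<in> \<int>"
  obtains A where "M = real_matrix A"
proof
  show "M = real_matrix (map_matrix floor M)"
    using assms by (simp add: vec_eq_iff)
qed

lemma det_real_matrix: "det (real_matrix A) = of_int (det A)"
  by (simp add: det_def)

lemma transpose_real_matrix: "real_matrix (transpose A) = transpose (real_matrix A)"
  by (simp add: vec_eq_iff transpose_def)

section \<open>Action-angle coordinates and their invariant tori\<close>

lemma angle_eq_refl [simp]: "angle_eq s s"
  unfolding angle_eq_def by (auto intro: exI[of _ 0])

lemma angle_eq_sym: "angle_eq s t \<Longrightarrow> angle_eq t s"
  unfolding angle_eq_def by (metis minus_diff_eq mult_minus_right of_int_minus)

lemma angle_eq_add:
  assumes "angle_eq s t" "angle_eq s' t'"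
  shows "angle_eq (s + s') (t + t')"
  unfolding angle_eq_def
proof
  fix j
  obtain k k' :: int where "s $ j - t $ j = 2 * pi * of_int k" "s' $ j - t' $ j = 2 * pi * of_int k'"
    using assms unfolding angle_eq_def by blast
  then have "(s + s') $ j - (t + t') $ j = 2 * pi * of_int (k + k')"
    by (simp add: algebra_simps)
  then show "\<exists>k::int. (s + s') $ j - (t + t') $ j = 2 * pi * of_int k"
    by blast
qed

lemma angle_eq_trans:
  assumes "angle_eq s t" "angle_eq t u"
  shows "angle_eq s u"
  using angle_eq_add[OF angle_eq_add[OF assms] angle_eq_refl[of "- t"]] by simp

text \<open>The compact box contains a fundamental domain of the torus; it supplies the compactness in the tube
  argument below.\<close>

lemma angle_eq_in_box:
  obtains s :: "real^'n" where "s \<in> cbox 0 (\<chi> i. 2 * pi)" "angle_eq s t"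
proof
  let ?s = "\<chi> i. 2 * pi * frac (t $ i / (2 * pi))"
  show "?s \<in> cbox 0 (\<chi> i. 2 * pi)"
    by (simp add: mem_box_cart frac_lt_1 less_imp_le)
  show "angle_eq ?s t"
    unfolding angle_eq_def
  proof
    fix j
    have "?s $ j - t $ j = 2 * pi * of_int (- \<lfloor>t $ j / (2 * pi)\<rfloor>)"
      by (simp add: frac_def field_simps)
    then show "\<exists>k::int. ?s $ j - t $ j = 2 * pi * of_int k"
      by blast
  qed
qed

text \<open>The data of \<^const>\<open>oriented_action_variables\<close> with its existential witnesses named, and without
  reference to a particular torus.\<close>

locale action_angle_system =
  fixes \<A> :: "('m::{t2_space,second_countable_topology}, 'e::euclidean_space) chart set"
    and \<omega> :: "('m, 'e) two_form"
    and F :: "'m \<Rightarrow> real^'n"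
    and U :: "'m set" and V :: "(real^'n) set"
    and I \<theta> :: "'m \<Rightarrow> real^'n"
    and G :: "real^'n \<Rightarrow> real^'n"
  assumes manifold: "smooth_manifold \<A>"
    and coordinates: "action_angle_coordinates \<A> \<omega> U V I \<theta>"
    and diffeo: "local_diffeo_on V G"
    and F_eq: "\<And>p. p \<in> U \<Longrightarrow> F p = G (I p)"
    and det_pos: "\<And>x. x \<in> V \<Longrightarrow> det (jacobian G (at x)) > 0"
begin

lemma open_U: "open U" and open_V: "open V" and I_in_V: "p \<in> U \<Longrightarrow> I p \<in> V"
  using coordinates by (auto simp: action_angle_coordinates_def)

lemma is_chart_atlas: "c \<in> \<A> \<Longrightarrow> is_chart c"
  using manifold by (simp add: smooth_manifold_def)

lemma atlas_covers: obtains c where "c \<in> \<A>" "p \<in> fst c"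
proof -
  have "p \<in> (\<Union>c\<in>\<A>. fst c)"
    using manifold unfolding smooth_manifold_def by simp
  then show ?thesis
    using that by blast
qed

text \<open>The angles \<open>\<theta>\<close> are defined modulo \<open>2\<pi>\<close> only and need not be continuous, so all calculus is
  done with a local real-valued lift \<open>\<phi>\<close>.\<close>

definition angle_lift :: "'m set \<Rightarrow> ('m \<Rightarrow> real^'n) \<Rightarrow> bool" where
  "angle_lift W \<phi> \<longleftrightarrow> W \<subseteq> U \<and> (\<forall>q\<in>W. angle_eq (\<phi> q) (\<theta> q)) \<and>
     symplectic_coordinates \<A> \<omega> (W, \<lambda>q. (I q, \<phi> q))"

lemma angle_liftD:
  assumes "angle_lift W \<phi>"
  shows "W \<subseteq> U" "\<And>q. q \<in> W \<Longrightarrow> angle_eq (\<phi> q) (\<theta> q)" "is_chart (W, \<lambda>q. (I q, \<phi> q))"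
    "\<And>c. c \<in> \<A> \<Longrightarrow> compatible c (W, \<lambda>q. (I q, \<phi> q))"
    "\<And>c q u v. c \<in> \<A> \<Longrightarrow> q \<in> fst c \<Longrightarrow> q \<in> W \<Longrightarrow> \<omega> c q u v =
      std_symplectic (differential c (\<lambda>q. (I q, \<phi> q)) q u) (differential c (\<lambda>q. (I q, \<phi> q)) q v)"
  using assms by (simp_all add: angle_lift_def symplectic_coordinates_def)

lemma angle_lift_exists:
  assumes "p \<in> U"
  obtains W \<phi> where "p \<in> W" "angle_lift W \<phi>"
proof -
  have "\<exists>W \<phi>. p \<in> W \<and> W \<subseteq> U \<and> (\<forall>q\<in>W. angle_eq (\<phi> q) (\<theta> q)) \<and>
      symplectic_coordinates \<A> \<omega> (W, \<lambda>q. (I q, \<phi> q))"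
    using coordinates assms unfolding action_angle_coordinates_def by (elim conjE) (rule bspec)
  then show ?thesis
    using that unfolding angle_lift_def by (elim exE conjE) blast
qed

lemma continuous_on_I: "continuous_on U I"
proof -
  have "isCont I p" if p: "p \<in> U" for p
  proof -
    obtain W \<phi> where W: "p \<in> W" "angle_lift W \<phi>"
      using angle_lift_exists[OF p] .
    have "continuous_on W (\<lambda>q. (I q, \<phi> q))" "open W"
      using is_chartD(1,3)[OF angle_liftD(3)[OF W(2)]] by simp_all
    from continuous_on_fst[OF this(1)] this(2) show ?thesis
      using W(1) by (simp add: continuous_on_eq_continuous_at)
  qed
  then show ?thesis
    by (simp add: continuous_at_imp_continuous_on)
qed

lemma has_derivative_I:
  assumes "c \<in> \<A>" "p \<in> fst c" "p \<in> W" "angle_lift W \<phi>"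
  shows "((I \<circ> chart_inv c) has_derivative
    (\<lambda>v. fst (differential c (\<lambda>q. (I q, \<phi> q)) p v))) (at (snd c p))"
proof -
  have "(((\<lambda>q. (I q, \<phi> q)) \<circ> chart_inv c) has_derivative differential c (\<lambda>q. (I q, \<phi> q)) p)
      (at (snd c p))"
    using has_derivative_transition[OF angle_liftD(4)[OF assms(4,1)]] assms(2,3) by simp
  from has_derivative_fst[OF this] show ?thesis
    by (simp add: comp_def)
qed

lemma G_differentiable: "x \<in> V \<Longrightarrow> G differentiable (at x)"
  using diffeo unfolding local_diffeo_on_def by (blast intro: smooth_on_differentiable)

lemma G_has_derivative:
  assumes "x \<in> V"
  shows "(G has_derivative (*v) (jacobian G (at x))) (at x)"
  using G_differentiable[OF assms] by (simp add: jacobian_works)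

lemma continuous_on_jacobian: "continuous_on V (\<lambda>x. jacobian G (at x))"
proof (rule continuous_on_matrix_entries)
  fix i j
  have "isCont (\<lambda>x. jacobian G (at x) $ i $ j) x" if x: "x \<in> V" for x
  proof -
    obtain X where X: "open X" "x \<in> X" "smooth_on X G"
      using diffeo x unfolding local_diffeo_on_def by blast
    have "continuous_on X (\<lambda>x. frechet_derivative G (at x) (axis j 1) $ i)"
      by (intro continuous_on_component smooth_on_continuous_frechet_derivative X(3))
    then show ?thesis
      using X(1,2) by (simp add: jacobian_def matrix_def continuous_on_eq_continuous_at)
  qed
  then show "continuous_on V (\<lambda>x. jacobian G (at x) $ i $ j)"
    by (simp add: continuous_at_imp_continuous_on)
qed

text \<open>Since \<open>F = G \<circ> I\<close>, the differential of \<open>F\<close> determines that of \<open>I\<close>. This is what allows two sets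
  of action variables of the same \<open>F\<close> to be compared.\<close>

lemma has_derivative_F:
  assumes "c \<in> \<A>" "p \<in> fst c" "p \<in> U"
  shows "((F \<circ> chart_inv c) has_derivative
    (\<lambda>v. jacobian G (at (I p)) *v differential c I p v)) (at (snd c p))"
proof -
  obtain W \<phi> where W: "p \<in> W" "angle_lift W \<phi>"
    using angle_lift_exists[OF assms(3)] .
  note c = is_chart_atlas[OF assms(1)]
  have "((I \<circ> chart_inv c) has_derivative differential c I p) (at (snd c p))"
    using has_derivative_I[OF assms(1,2) W] differential_eqI[OF has_derivative_I[OF assms(1,2) W]] by simp
  moreover have "(G has_derivative (*v) (jacobian G (at (I p)))) (at ((I \<circ> chart_inv c) (snd c p)))"
    using G_has_derivative[OF I_in_V[OF assms(3)]] by (simp add: is_chartD(5)[OF c assms(2)])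
  ultimately have "((G \<circ> (I \<circ> chart_inv c)) has_derivative
      (*v) (jacobian G (at (I p))) \<circ> differential c I p) (at (snd c p))"
    by (rule diff_chain_at)
  moreover have "open (snd c ` (fst c \<inter> U))"
    using is_chartD(1)[OF c] open_U by (intro open_chart_image[OF c]) auto
  moreover have "snd c p \<in> snd c ` (fst c \<inter> U)"
    using assms by blast
  moreover have "(G \<circ> (I \<circ> chart_inv c)) y = (F \<circ> chart_inv c) y"
    if "y \<in> snd c ` (fst c \<inter> U)" for y
    using that F_eq is_chartD(5)[OF c] by auto
  ultimately have "((F \<circ> chart_inv c) has_derivative
      (*v) (jacobian G (at (I p))) \<circ> differential c I p) (at (snd c p))"
    by (rule has_derivative_transform_within_open)
  then show ?thesis
    by (simp add: comp_def)
qed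

text \<open>On a level set of \<open>F\<close> the actions take values in a fibre of \<open>G\<close>, and this fibre is discrete
  because \<open>G\<close> is locally injective.\<close>

lemma I_const_on_connected_level:
  assumes "connected S" "S \<subseteq> U" and F: "\<And>p. p \<in> S \<Longrightarrow> F p = y" and "p \<in> S" "q \<in> S"
  shows "I p = I q"
proof (rule connected_local_const[OF assms(1,4,5)], intro ballI)
  fix a assume a: "a \<in> S"
  then have "I a \<in> V"
    using assms(2) I_in_V by blast
  then obtain X Y K where X: "open X" "I a \<in> X" and K: "homeomorphism X Y G K"
    using diffeo unfolding local_diffeo_on_def by blast
  have "isCont I a"
    using continuous_on_I open_U a assms(2) by (auto simp: continuous_on_eq_continuous_at)
  then have "eventually (\<lambda>b. I b \<in> X) (at a)"
    using X by (metis isCont_def topological_tendstoD)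
  then have "eventually (\<lambda>b. I b \<in> X) (at a within S)"
    by (rule filter_leD[OF at_le[OF subset_UNIV]])
  moreover have "eventually (\<lambda>b. b \<in> S) (at a within S)"
    by (simp add: eventually_at_filter)
  ultimately show "eventually (\<lambda>b. I a = I b) (at a within S)"
  proof eventually_elim
    case (elim b)
    have "G (I a) = G (I b)"
      using F[OF a] F[OF elim(2)] F_eq a elim(2) assms(2) by (metis subsetD)
    then show ?case
      using homeomorphism_apply1[OF K X(2)] homeomorphism_apply1[OF K elim(1)] by metis
  qed
qed

text \<open>The covering \<open>V \<times> \<real>\<^sup>n \<rightarrow> U\<close> given by the action-angle coordinates. For fixed \<open>x\<close> it
  parametrizes the torus \<open>I = x\<close>; letting \<open>t\<close> vary takes the place of the joint Hamiltonian flow of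
  the actions.\<close>

definition torus_point :: "real^'n \<Rightarrow> real^'n \<Rightarrow> 'm" where
  "torus_point x t = (THE p. p \<in> U \<and> I p = x \<and> angle_eq (\<theta> p) t)"

lemma torus_point:
  assumes "x \<in> V"
  shows "torus_point x t \<in> U" "I (torus_point x t) = x" "angle_eq (\<theta> (torus_point x t)) t"
proof -
  have "\<exists>!p. p \<in> U \<and> I p = x \<and> angle_eq (\<theta> p) t"
    using coordinates assms unfolding action_angle_coordinates_def by blast
  from theI'[OF this] show "torus_point x t \<in> U" "I (torus_point x t) = x"
    "angle_eq (\<theta> (torus_point x t)) t"
    unfolding torus_point_def by blast+
qed

lemma torus_point_unique:
  assumes "p \<in> U" "angle_eq (\<theta> p) t"
  shows "torus_point (I p) t = p"
proof -
  have "\<exists>!q. q \<in> U \<and> I q = I p \<and> angle_eq (\<theta> q) t"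
    using coordinates I_in_V[OF assms(1)] unfolding action_angle_coordinates_def by blast
  then show ?thesis
    using torus_point[OF I_in_V[OF assms(1)]] assms by metis
qed

lemma torus_point_periodic:
  assumes "x \<in> V" "angle_eq s t"
  shows "torus_point x s = torus_point x t"
  using torus_point_unique[of "torus_point x s" t] torus_point[OF assms(1), of s]
    angle_eq_trans[OF _ assms(2)] by simp

lemma torus_point_range:
  assumes "x \<in> V"
  shows "range (torus_point x) = {p \<in> U. I p = x}"
proof safe
  fix p assume "p \<in> U" "x = I p"
  then show "p \<in> range (torus_point (I p))"
    using torus_point_unique[OF _ angle_eq_refl, of p] by (intro image_eqI[of _ _ "\<theta> p"]) simp_all
qed (simp_all add: torus_point[OF assms])

text \<open>Near a given point, moving along the torus is translation in the angle coordinates.\<close>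

lemma torus_point_local:
  assumes x: "x \<in> V" and W: "torus_point x t \<in> W" and lift: "angle_lift W \<phi>"
  obtains N a where "open N" "(x, t) \<in> N"
    "\<forall>(y, s)\<in>N. (y, s + a) \<in> (\<lambda>q. (I q, \<phi> q)) ` W"
    "\<forall>(y, s)\<in>N. torus_point y s = chart_inv (W, \<lambda>q. (I q, \<phi> q)) (y, s + a)"
proof -
  let ?d = "(W, \<lambda>q. (I q, \<phi> q))" and ?p = "torus_point x t"
  note WU = angle_liftD(1)[OF lift] and chart = angle_liftD(3)[OF lift]
  \<comment> \<open>The lift need not take the value \<open>t\<close> at the point itself; it is off by a multiple of \<open>2\<pi>\<close>.\<close>
  define a where "a = \<phi> ?p - t"
  define N where "N = (\<lambda>z. (fst z, snd z + a)) -` ((\<lambda>q. (I q, \<phi> q)) ` W)"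
  have a: "angle_eq a 0"
    using angle_eq_add[OF angle_eq_trans[OF angle_liftD(2)[OF lift W] torus_point(3)[OF x]] angle_eq_refl[of "- t"]]
    by (simp add: a_def)
  have N: "(y, s) \<in> N \<longleftrightarrow> (\<exists>q\<in>W. y = I q \<and> s + a = \<phi> q)" for y s
    by (auto simp: N_def image_iff)
  show ?thesis
  proof (rule that)
    show "open N"
      unfolding N_def using is_chartD(2)[OF chart] by (intro open_vimage continuous_intros) simp_all
    show "(x, t) \<in> N"
      unfolding N using W torus_point(2)[OF x] by (intro bexI[of _ ?p]) (simp_all add: a_def)
    show "\<forall>(y, s)\<in>N. (y, s + a) \<in> (\<lambda>q. (I q, \<phi> q)) ` W"
      by (auto simp: N_def)
    have "torus_point y s = chart_inv ?d (y, s + a)" if ys: "(y, s) \<in> N" for y s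
    proof -
      obtain q where q: "q \<in> W" "y = I q" "s + a = \<phi> q"
        using N ys by blast
      have "angle_eq (s + a) s"
        using angle_eq_add[OF angle_eq_refl a] by simp
      then have "angle_eq (\<theta> q) s"
        using angle_eq_trans[OF angle_eq_sym[OF angle_liftD(2)[OF lift q(1)]]] q(3) by simp
      then have "torus_point y s = q"
        using torus_point_unique q(1,2) WU by blast
      then show ?thesis
        using is_chartD(5)[OF chart, of q] q by simp
    qed
    then show "\<forall>(y, s)\<in>N. torus_point y s = chart_inv ?d (y, s + a)"
      by blast
  qed
qed

lemma continuous_on_torus_point: "continuous_on (V \<times> UNIV) (\<lambda>z. torus_point (fst z) (snd z))"
proof -
  have "isCont (\<lambda>z. torus_point (fst z) (snd z)) (x, t)" if x: "x \<in> V" for x t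
  proof -
    obtain W \<phi> where W: "torus_point x t \<in> W" "angle_lift W \<phi>"
      using angle_lift_exists[OF torus_point(1)[OF x]] .
    let ?d = "(W, \<lambda>q. (I q, \<phi> q))"
    obtain N a where N: "open N" "(x, t) \<in> N"
      "\<forall>(y, s)\<in>N. (y, s + a) \<in> (\<lambda>q. (I q, \<phi> q)) ` W"
      "\<forall>(y, s)\<in>N. torus_point y s = chart_inv ?d (y, s + a)"
      using torus_point_local[OF x W] .
    have "continuous_on N (\<lambda>z. chart_inv ?d (fst z, snd z + a))"
      by (rule continuous_on_compose2[OF is_chartD(4)[OF angle_liftD(3)[OF W(2)]]])
        (use N(3) in \<open>auto intro!: continuous_intros\<close>)
    then have "continuous_on N (\<lambda>z. torus_point (fst z) (snd z))"
      by (rule continuous_on_eq) (use N(4) in auto)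
    then show ?thesis
      using N(1,2) by (simp add: continuous_on_eq_continuous_at)
  qed
  then show ?thesis
    by (intro continuous_at_imp_continuous_on) auto
qed

lemma continuous_on_torus_point_fibre:
  assumes "x \<in> V"
  shows "continuous_on UNIV (torus_point x)"
  using continuous_on_compose2[OF continuous_on_torus_point, of UNIV "\<lambda>t. (x, t)"] assms
  by (simp add: continuous_intros image_subset_iff)

lemma connected_fibre:
  assumes "x \<in> V"
  shows "connected {p \<in> U. I p = x}"
  using connected_continuous_image[OF continuous_on_torus_point_fibre[OF assms] connected_UNIV]
  by (simp add: torus_point_range[OF assms])

lemma connected_tube:
  assumes "connected B" "B \<subseteq> V"
  shows "connected {p \<in> U. I p \<in> B}"
proof -
  have "connected ((\<lambda>z. torus_point (fst z) (snd z)) ` (B \<times> UNIV))"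
    using assms by (intro connected_continuous_image connected_Times connected_UNIV
      continuous_on_subset[OF continuous_on_torus_point]) auto
  also have "(\<lambda>z. torus_point (fst z) (snd z)) ` (B \<times> UNIV) = {p \<in> U. I p \<in> B}"
  proof safe
    fix p assume "p \<in> U" "I p \<in> B"
    then show "p \<in> (\<lambda>z. torus_point (fst z) (snd z)) ` (B \<times> UNIV)"
      using torus_point_unique[OF \<open>p \<in> U\<close> angle_eq_refl] by (intro image_eqI[of _ _ "(I p, \<theta> p)"]) auto
  qed (use assms torus_point in auto)
  finally show ?thesis .
qed

text \<open>A tube lemma: the torus \<open>I = x\<close> is covered by the compact box of angles, so every neighbourhood
  of it contains all nearby tori entirely.\<close>

lemma fibre_neighbourhood:
  assumes x: "x \<in> V" and N: "open N" "{p \<in> U. I p = x} \<subseteq> N"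
  obtains r where "r > 0" "ball x r \<subseteq> V" "{p \<in> U. I p \<in> ball x r} \<subseteq> N"
proof -
  let ?P = "\<lambda>z. torus_point (fst z) (snd z)" and ?C = "cbox (0::real^'n) (\<chi> i. 2 * pi)"
  have pre: "open (V \<times> UNIV \<inter> ?P -` N)"
    using continuous_on_torus_point open_V N(1)
    by (intro continuous_open_preimage) (auto intro: open_Times)
  have sub: "{x} \<times> ?C \<subseteq> V \<times> UNIV \<inter> ?P -` N"
  proof -
    have "torus_point x s \<in> N" for s
      by (rule subsetD[OF N(2)]) (simp add: torus_point[OF x])
    then show ?thesis
      using x by auto
  qed
  obtain X where X: "open X" "x \<in> X" "X \<times> ?C \<subseteq> V \<times> UNIV \<inter> ?P -` N"
    using Elementary_Topology.tube_lemma[OF compact_cbox pre sub] by blast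
  obtain r where r: "r > 0" "ball x r \<subseteq> X \<inter> V"
    using X(1,2) x open_V by (meson IntI open_Int open_contains_ball)
  show ?thesis
  proof (rule that[OF r(1)])
    show "ball x r \<subseteq> V"
      using r(2) by blast
    show "{p \<in> U. I p \<in> ball x r} \<subseteq> N"
    proof
      fix p assume p: "p \<in> {p \<in> U. I p \<in> ball x r}"
      obtain s where s: "s \<in> ?C" "angle_eq s (\<theta> p)"
        using angle_eq_in_box by metis
      have "torus_point (I p) s = p"
        using torus_point_unique[OF _ angle_eq_sym[OF s(2)]] p by simp
      moreover have "(I p, s) \<in> X \<times> ?C"
        using p s(1) r(2) by auto
      ultimately show "p \<in> N"
        using X(3) by auto
    qed
  qed
qed

text \<open>The torus lies in one fibre of \<open>I\<close>, as \<open>I\<close> is constant on connected level sets of \<open>F\<close>. It fills the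
  fibre, since the fibre is connected and a component is maximal.\<close>

lemma liouville_torus_is_fibre:
  assumes "liouville_torus \<A> F \<Lambda>" "\<Lambda> \<subseteq> U"
  obtains x where "x \<in> V" "\<Lambda> = {p \<in> U. I p = x}"
proof -
  obtain y where y: "\<Lambda> \<in> components (F -` {y})"
    using assms(1) unfolding liouville_torus_def by blast
  obtain p where p: "p \<in> \<Lambda>"
    using in_components_nonempty[OF y] by blast
  have F: "F q = y" if "q \<in> \<Lambda>" for q
    using in_components_subset[OF y] that by blast
  have const: "I q = I p" if "q \<in> \<Lambda>" for q
    using I_const_on_connected_level[OF in_components_connected[OF y] assms(2) F that p] .
  have x: "I p \<in> V"
    by (rule I_in_V[OF subsetD[OF assms(2) p]])
  have "F q = y" if "q \<in> {q \<in> U. I q = I p}" for q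
    using that F[OF p] F_eq[OF subsetD[OF assms(2) p]] F_eq[of q] by simp
  moreover have "p \<in> \<Lambda> \<inter> {q \<in> U. I q = I p}"
    using p assms(2) by blast
  ultimately have "{q \<in> U. I q = I p} \<subseteq> \<Lambda>"
    by (intro components_maximal[OF y connected_fibre[OF x]]) blast+
  then have "\<Lambda> = {q \<in> U. I q = I p}"
    using const assms(2) by (intro equalityI subsetI) auto
  then show ?thesis
    by (rule that[OF x])
qed

text \<open>On the open set \<open>V\<close> of values of \<open>I\<close> the function \<open>g\<close> is the component \<open>h\<close> of \<open>G\<close>, so its
  gradient is a row of the Jacobian matrix of \<open>G\<close>.\<close>

lemma rotation_vector_row:
  assumes torus: "liouville_torus \<A> F \<Lambda>" "\<Lambda> \<subseteq> U" and p: "p \<in> \<Lambda>"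
    and g: "\<And>p. p \<in> U \<Longrightarrow> F p $ h = g (I p)"
  shows "rotation_vector g I \<Lambda> = jacobian G (at (I p)) $ h"
proof -
  obtain x where x: "x \<in> V" "\<Lambda> = {p \<in> U. I p = x}"
    using liouville_torus_is_fibre[OF torus] .
  then have "I p = x" "I ` \<Lambda> = {x}"
    using p by auto
  have "((\<lambda>y. G y $ h) has_derivative (\<lambda>v. (jacobian G (at x) *v v) $ h)) (at x)"
    by (rule bounded_linear.has_derivative[OF bounded_linear_vec_nth G_has_derivative[OF x(1)]])
  moreover have "G y $ h = g y" if "y \<in> V" for y
    using g[OF torus_point(1)[OF that]] F_eq[OF torus_point(1)[OF that]] torus_point(2)[OF that]
    by metis
  ultimately have "(g has_derivative (\<lambda>v. (jacobian G (at x) *v v) $ h)) (at x)"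
    by (rule has_derivative_transform_within_open[OF _ open_V x(1)])
  then have "frechet_derivative g (at x) = (\<lambda>v. (jacobian G (at x) *v v) $ h)"
    by (rule frechet_derivative_at[symmetric])
  then show ?thesis
    unfolding \<open>I p = x\<close> using \<open>I ` \<Lambda> = {x}\<close>
    by (simp add: rotation_vector_def vec_eq_iff matrix_vector_mult_basis column_def)
qed

lemma rotation_vector_nonzero:
  assumes torus: "liouville_torus \<A> F \<Lambda>" "\<Lambda> \<subseteq> U" and g: "\<And>p. p \<in> U \<Longrightarrow> F p $ h = g (I p)"
  shows "rotation_vector g I \<Lambda> \<noteq> 0"
proof -
  obtain p where p: "p \<in> \<Lambda>"
    using torus(1) in_components_nonempty unfolding liouville_torus_def by blast
  have "det (jacobian G (at (I p))) \<noteq> 0"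
    using det_pos[OF I_in_V[OF subsetD[OF torus(2) p]]] by simp
  then have "jacobian G (at (I p)) $ h \<noteq> 0"
    using det_zero_row(2)[of h "jacobian G (at (I p))"] by (auto simp: row_def)
  then show ?thesis
    by (simp add: rotation_vector_row[OF torus p g])
qed

end

section \<open>Comparison of two sets of action variables\<close>

locale two_action_angle_systems =
  A: action_angle_system \<A> \<omega> F U V I \<theta> G + B: action_angle_system \<A> \<omega> F U' V' I' \<theta>' G'
  for \<A> :: "('m::{t2_space,second_countable_topology}, 'e::euclidean_space) chart set"
    and \<omega> and F :: "'m \<Rightarrow> real^'n" and U V I \<theta> G U' V' I' \<theta>' G'
begin

text \<open>The matrix \<open>DG(I)\<^sup>-\<^sup>1 DG'(I')\<close>, which is the only candidate for \<open>A\<close> because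
  \<open>DG(I) dI = dF = DG'(I') dI'\<close>.\<close>

definition transition_matrix :: "'m \<Rightarrow> real^'n^'n" where
  "transition_matrix p = matrix_inv (jacobian G (at (I p))) ** jacobian G' (at (I' p))"

lemma invertible_jacobian:
  "p \<in> U \<Longrightarrow> invertible (jacobian G (at (I p)))" "p \<in> U' \<Longrightarrow> invertible (jacobian G' (at (I' p)))"
  using A.det_pos[OF A.I_in_V] B.det_pos[OF B.I_in_V] by (simp_all add: invertible_det_nz less_imp_neq[symmetric])

lemma jacobian_transition_matrix:
  assumes "p \<in> U"
  shows "jacobian G (at (I p)) ** transition_matrix p = jacobian G' (at (I' p))"
  using invertible_inverse_mult(1)[OF invertible_jacobian(1)[OF assms]]
  by (simp add: transition_matrix_def matrix_mul_assoc)

lemma differential_transition_matrix: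
  assumes "c \<in> \<A>" "p \<in> fst c" "p \<in> U" "p \<in> U'"
  shows "differential c I p v = transition_matrix p *v differential c I' p v"
proof -
  have "jacobian G (at (I p)) *v differential c I p v = jacobian G' (at (I' p)) *v differential c I' p v"
    using has_derivative_unique[OF A.has_derivative_F[OF assms(1-3)] B.has_derivative_F[OF assms(1,2,4)]]
    by (rule fun_cong)
  then have "matrix_inv (jacobian G (at (I p))) *v (jacobian G (at (I p)) *v differential c I p v) =
      transition_matrix p *v differential c I' p v"
    by (simp add: transition_matrix_def matrix_vector_mul_assoc)
  then show ?thesis
    by (simp add: matrix_vector_mul_assoc invertible_inverse_mult(2)[OF invertible_jacobian(1)[OF assms(3)]])
qed

lemma det_transition_matrix_pos:
  assumes "p \<in> U" "p \<in> U'"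
  shows "det (transition_matrix p) > 0"
proof -
  have "det (jacobian G (at (I p))) * det (transition_matrix p) > 0"
    using jacobian_transition_matrix[OF assms(1)] B.det_pos[OF B.I_in_V[OF assms(2)]]
    by (simp add: det_mul[symmetric])
  then show ?thesis
    using A.det_pos[OF A.I_in_V[OF assms(1)]] by (simp add: zero_less_mult_iff)
qed

lemma continuous_on_transition_matrix:
  "continuous_on (U \<inter> U') (\<lambda>p. transition_matrix p $ i $ j)"
  unfolding transition_matrix_def
proof (rule continuous_on_matrix_left_division)
  show "continuous_on (U \<inter> U') (\<lambda>p. jacobian G (at (I p)))"
    by (rule continuous_on_compose2[OF A.continuous_on_jacobian])
      (use A.continuous_on_I A.I_in_V in \<open>auto intro: continuous_on_subset\<close>)
  show "continuous_on (U \<inter> U') (\<lambda>p. jacobian G' (at (I' p)))"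
    by (rule continuous_on_compose2[OF B.continuous_on_jacobian])
      (use B.continuous_on_I B.I_in_V in \<open>auto intro: continuous_on_subset\<close>)
  fix p assume "p \<in> U \<inter> U'"
  then show "det (jacobian G (at (I p))) \<noteq> 0"
    using A.det_pos[OF A.I_in_V, of p] by simp
qed

text \<open>Translating \<open>\<theta>\<close> by \<open>e\<close> moves along a tangent vector \<open>u\<close> with \<open>dI(u) = 0\<close> and \<open>d\<theta>(u) = e\<close>.
  Both coordinate systems put the symplectic form into the same normal form and \<open>dI = M dI'\<close>, hence
  \<open>d\<theta>'(u)\<close> is the transpose of \<open>M\<close> applied to \<open>e\<close>.\<close>

lemma has_derivative_lift_along_torus:
  assumes lift: "A.angle_lift W \<phi>" and lift': "B.angle_lift W' \<phi>'"
    and p: "p \<in> W" "p \<in> W'" and coord: "(I p, \<phi> p) = (x, t + a)"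
  shows "((\<lambda>s. \<phi>' (chart_inv (W, \<lambda>q. (I q, \<phi> q)) (x, s + a))) has_derivative
    (*v) (transpose (transition_matrix p))) (at t)"
proof -
  let ?d = "(W, \<lambda>q. (I q, \<phi> q))" and ?d' = "(W', \<lambda>q. (I' q, \<phi>' q))"
  obtain c where c: "c \<in> \<A>" "p \<in> fst c"
    using A.atlas_covers .
  let ?D = "differential c (\<lambda>q. (I q, \<phi> q)) p" and ?D' = "differential c (\<lambda>q. (I' q, \<phi>' q)) p"
    and ?Q = "differential ?d (snd c) p"
  have U: "p \<in> U" "p \<in> U'"
    using p A.angle_liftD(1)[OF lift] B.angle_liftD(1)[OF lift'] by auto
  note chart = A.is_chart_atlas[OF c(1)]
  note d = A.angle_liftD(3)[OF lift] A.angle_liftD(4)[OF lift c(1)]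
  note d' = B.angle_liftD(3)[OF lift'] B.angle_liftD(4)[OF lift' c(1)]
  have D'Q: "snd (?D' (?Q (0, e))) = transpose (transition_matrix p) *v e" for e
  proof -
    have DQ: "?D (?Q (0, e)) = (0, e)"
      using differential_transition_inverse[OF chart d, of p] p c(2) by simp
    have "fst (?D' (?Q (0, e))) = 0 \<and>
        snd (?D' (?Q (0, e))) = transpose (transition_matrix p) *v snd (?D (?Q (0, e)))"
    proof (rule symplectic_transpose[where D = "?D"])
      show "std_symplectic (?D (?Q (0, e))) (?D v) = std_symplectic (?D' (?Q (0, e))) (?D' v)" for v
        using A.angle_liftD(5)[OF lift c p(1)] B.angle_liftD(5)[OF lift' c p(2)] by simp
      show "fst (?D v) = transition_matrix p *v fst (?D' v)" for v
        using differential_transition_matrix[OF c U]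
          differential_eqI[OF A.has_derivative_I[OF c p(1) lift]]
          differential_eqI[OF B.has_derivative_I[OF c p(2) lift']] by simp
      have "?D' (differential ?d' (snd c) p w) = w" for w
        using differential_transition_inverse[OF chart d', of p] p c(2) by simp
      then show "surj ?D'"
        by (rule surjI)
      show "invertible (transition_matrix p)"
        using det_transition_matrix_pos[OF U] by (simp add: invertible_det_nz)
    qed (simp add: DQ)
    then show ?thesis
      by (simp add: DQ)
  qed
  have "((snd ?d' \<circ> chart_inv ?d) has_derivative ?D' \<circ> ?Q) (at (snd ?d p))"
  proof -
    have "((snd ?d' \<circ> chart_inv c) has_derivative ?D') (at (snd c p))"
      using has_derivative_transition[OF d'(2), of p] c(2) p(2) by simp
    from has_derivative_change_chart[OF d(1) chart compatible_sym[OF d(2)] _ this]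
    show ?thesis
      using c(2) p(1) by simp
  qed
  then have "((snd ?d' \<circ> chart_inv ?d) has_derivative ?D' \<circ> ?Q) (at ((\<lambda>s. (x, s + a)) t))"
    using coord by simp
  moreover have "((\<lambda>s. (x, s + a)) has_derivative (\<lambda>e. (0, e))) (at t)"
    by (auto intro!: derivative_eq_intros)
  ultimately have "(((snd ?d' \<circ> chart_inv ?d) \<circ> (\<lambda>s. (x, s + a))) has_derivative
      (?D' \<circ> ?Q) \<circ> (\<lambda>e. (0, e))) (at t)"
    by (intro diff_chain_at)
  from has_derivative_snd[OF this] show ?thesis
    by (simp add: comp_def D'Q del: transpose_matrix_vector)
qed

text \<open>The matrix depends on \<open>I\<close> and \<open>I'\<close> only, and on a connected fibre of \<open>I\<close> the map \<open>F\<close>, hence also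
  \<open>I'\<close>, is constant.\<close>

lemma transition_matrix_const_on_fibre:
  assumes x: "x \<in> V" and fibre: "{p \<in> U. I p = x} \<subseteq> U'" and "p \<in> U" "I p = x" "q \<in> U" "I q = x"
  shows "transition_matrix p = transition_matrix q"
proof -
  have "I' p = I' q"
    by (rule B.I_const_on_connected_level[OF A.connected_fibre[OF x] fibre, of "G x"])
      (use assms A.F_eq in auto)
  then show ?thesis
    using assms by (simp add: transition_matrix_def)
qed

text \<open>A lift of \<open>\<theta>'\<close> has constant derivative along the torus, so it is affine in the angle \<open>s\<close> as
  long as it is defined.\<close>

lemma angle_along_torus_local:
  assumes x: "x \<in> V" and fibre: "{p \<in> U. I p = x} \<subseteq> U'"
    and M: "\<And>p. p \<in> U \<Longrightarrow> I p = x \<Longrightarrow> transition_matrix p = M"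
  obtains e where "e > 0" "\<And>s. s \<in> ball t e \<Longrightarrow>
    angle_eq (\<theta>' (A.torus_point x s) - transpose M *v s)
      (\<theta>' (A.torus_point x t) - transpose M *v t)"
proof -
  let ?p = "A.torus_point x t"
  note P = A.torus_point(1,2)[OF x]
  have U': "A.torus_point x s \<in> U'" for s
    using fibre P by blast
  obtain W \<phi> where W: "?p \<in> W" "A.angle_lift W \<phi>"
    using A.angle_lift_exists[OF P(1)] .
  obtain W' \<phi>' where W': "?p \<in> W'" "B.angle_lift W' \<phi>'"
    using B.angle_lift_exists[OF U'] .
  let ?d = "(W, \<lambda>q. (I q, \<phi> q))"
  note d = A.angle_liftD(3)[OF W(2)] and d' = B.angle_liftD(3)[OF W'(2)]
  obtain N a where N: "open N" "(x, t) \<in> N"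
    "\<forall>(y, s)\<in>N. (y, s + a) \<in> (\<lambda>q. (I q, \<phi> q)) ` W"
    "\<forall>(y, s)\<in>N. A.torus_point y s = chart_inv ?d (y, s + a)"
    using A.torus_point_local[OF x W] .
  define S where "S = (\<lambda>s. (x, s)) -` N \<inter> A.torus_point x -` W'"
  have "open S"
    unfolding S_def using is_chartD(1)[OF d'] N(1) A.continuous_on_torus_point_fibre[OF x]
    by (intro open_Int open_vimage continuous_intros) simp_all
  moreover have "t \<in> S"
    using N(2) W'(1) by (simp add: S_def)
  ultimately obtain e where e: "e > 0" "ball t e \<subseteq> S"
    using open_contains_ball by blast
  have in_N: "(x, s) \<in> N" "A.torus_point x s \<in> W'" if "s \<in> ball t e" for s
    using subsetD[OF e(2) that] by (simp_all add: S_def)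
  have chart_s: "A.torus_point x s = chart_inv ?d (x, s + a)" if "s \<in> ball t e" for s
    using bspec[OF N(4) in_N(1)[OF that]] by simp
  let ?f = "\<lambda>s. \<phi>' (chart_inv ?d (x, s + a)) - transpose M *v s"
  have "(?f has_derivative (\<lambda>h. 0)) (at s within ball t e)" if s: "s \<in> ball t e" for s
  proof -
    let ?q = "A.torus_point x s"
    have im: "(x, s + a) \<in> snd ?d ` fst ?d"
      using bspec[OF N(3) in_N(1)[OF s]] by simp
    have q: "(I ?q, \<phi> ?q) = (x, s + a)"
      using is_chartD(6)[OF d im] chart_s[OF s] by simp
    have "?q \<in> W"
      using is_chartD(7)[OF d im] chart_s[OF s] by simp
    from has_derivative_lift_along_torus[OF W(2) W'(2) this in_N(2)[OF s] q]
    have "((\<lambda>s. \<phi>' (chart_inv ?d (x, s + a))) has_derivative (*v) (transpose M)) (at s)"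
      using M[OF P] by simp
    from has_derivative_diff[OF this bounded_linear_imp_has_derivative[OF matrix_vector_mul_bounded_linear, of "transpose M"]]
    show ?thesis
      by (simp add: has_derivative_at_withinI)
  qed
  from has_derivative_zero_constant[OF convex_ball this]
  obtain k where k: "\<And>s. s \<in> ball t e \<Longrightarrow> ?f s = k"
    by blast
  have eq: "angle_eq (\<theta>' (A.torus_point x s) - transpose M *v s) k" if s: "s \<in> ball t e" for s
  proof -
    have "angle_eq (\<theta>' (A.torus_point x s) + - (transpose M *v s))
        (\<phi>' (A.torus_point x s) + - (transpose M *v s))"
      by (rule angle_eq_add[OF angle_eq_sym[OF B.angle_liftD(2)[OF W'(2) in_N(2)[OF s]]] angle_eq_refl])
    then show ?thesis
      using k[OF s] chart_s[OF s] by simp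
  qed
  show ?thesis
  proof (rule that[OF e(1)])
    fix s assume "s \<in> ball t e"
    then show "angle_eq (\<theta>' (A.torus_point x s) - transpose M *v s)
        (\<theta>' (A.torus_point x t) - transpose M *v t)"
      using angle_eq_trans[OF eq angle_eq_sym[OF eq]] e(1) by simp
  qed
qed

text \<open>The residue class modulo \<open>2\<pi>\<close> of the difference is locally constant on all of \<open>\<real>\<^sup>n\<close>, so no
  global lift of \<open>\<theta>'\<close> has to be constructed.\<close>

lemma angle_along_torus:
  assumes x: "x \<in> V" and fibre: "{p \<in> U. I p = x} \<subseteq> U'"
    and M: "\<And>p. p \<in> U \<Longrightarrow> I p = x \<Longrightarrow> transition_matrix p = M"
  shows "angle_eq (\<theta>' (A.torus_point x s) - transpose M *v s)
      (\<theta>' (A.torus_point x t) - transpose M *v t)"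
proof -
  let ?f = "\<lambda>t. \<theta>' (A.torus_point x t) - transpose M *v t"
  \<comment> \<open>Equivalence classes turn congruence into an equation, so that local constancy applies.\<close>
  have "{z. angle_eq z (?f s)} = {z. angle_eq z (?f t)}"
  proof (rule connected_local_const[where f = "\<lambda>t. {z. angle_eq z (?f t)}",
        OF connected_UNIV UNIV_I UNIV_I], rule ballI)
    fix a :: "real^'n"
    obtain e where e: "e > 0" "\<And>s. s \<in> ball a e \<Longrightarrow> angle_eq (?f s) (?f a)"
      using angle_along_torus_local[OF x fibre M] by blast
    have "{z. angle_eq z (?f a)} = {z. angle_eq z (?f b)}" if "b \<in> ball a e" for b
      using e(2)[OF that] by (blast intro: angle_eq_trans angle_eq_sym)
    then show "eventually (\<lambda>b. {z. angle_eq z (?f a)} = {z. angle_eq z (?f b)}) (at a within UNIV)"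
      unfolding eventually_at using e(1) by (intro exI[of _ e]) (simp add: dist_commute)
  qed
  then show ?thesis
    using angle_eq_refl by blast
qed

text \<open>One turn around the \<open>i\<close>-th circle of the torus \<open>I = const\<close> returns to the same point, but changes
  \<open>\<theta>'\<close> by \<open>2\<pi>\<close> times the \<open>i\<close>-th row of the matrix. The torus has to lie in \<open>U'\<close> entirely.\<close>

lemma transition_matrix_integral:
  assumes p: "p \<in> U" and fibre: "{q \<in> U. I q = I p} \<subseteq> U'"
  shows "transition_matrix p $ i $ j \<in> \<int>"
proof -
  let ?M = "transition_matrix p" and ?t = "axis i (2 * pi) :: real^'n"
  note x = A.I_in_V[OF p]
  have "angle_eq ?t 0"
    unfolding angle_eq_def axis_def by (auto intro: exI[of _ 0] exI[of _ 1])
  then have same: "A.torus_point (I p) ?t = A.torus_point (I p) 0"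
    by (rule A.torus_point_periodic[OF x])
  have "angle_eq (\<theta>' (A.torus_point (I p) 0)) (\<theta>' (A.torus_point (I p) 0) - transpose ?M *v ?t)"
    using angle_along_torus[OF x fibre transition_matrix_const_on_fibre[OF x fibre _ _ p refl], of 0 ?t]
    by (simp add: same)
  then obtain k :: int where "(transpose ?M *v ?t) $ j = 2 * pi * of_int k"
    unfolding angle_eq_def by auto
  moreover have "(transpose ?M *v ?t) $ j = 2 * pi * ?M $ i $ j"
    by (simp add: vector_matrix_mult_def axis_def if_distrib[of "\<lambda>x. x * _"] cong: if_cong)
  ultimately have "?M $ i $ j = of_int k"
    by simp
  then show ?thesis
    by simp
qed

text \<open>Exchanging the roles of the two systems shows that the inverse matrix is integral as well; the
  orientations exclude the determinant \<open>-1\<close>.\<close>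

lemma transition_matrix_SL:
  assumes p: "p \<in> U" "p \<in> U'" and fibre: "{q \<in> U. I q = I p} \<subseteq> U'" "{q \<in> U'. I' q = I' p} \<subseteq> U"
  obtains A where "A \<in> SL_int" "transition_matrix p = real_matrix A"
proof -
  interpret C: two_action_angle_systems \<A> \<omega> F U' V' I' \<theta>' G' U V I \<theta> G ..
  obtain A where A: "transition_matrix p = real_matrix A"
    using integral_real_matrix[OF transition_matrix_integral[OF p(1) fibre(1)]] .
  obtain B where B: "C.transition_matrix p = real_matrix B"
    using integral_real_matrix[OF C.transition_matrix_integral[OF p(2) fibre(2)]] .
  have "jacobian G (at (I p)) ** (transition_matrix p ** C.transition_matrix p) = jacobian G (at (I p))"
    using jacobian_transition_matrix[OF p(1)] C.jacobian_transition_matrix[OF p(2)]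
    by (simp add: matrix_mul_assoc)
  then have "det (jacobian G (at (I p))) * (det (transition_matrix p) * det (C.transition_matrix p)) =
      det (jacobian G (at (I p)))"
    by (metis det_mul)
  then have "det (transition_matrix p) * det (C.transition_matrix p) = 1"
    using A.det_pos[OF A.I_in_V[OF p(1)]] by simp
  then have "real_of_int (det A * det B) = 1"
    by (simp add: A B det_real_matrix)
  then have "det A * det B = 1"
    by (simp only: of_int_eq_1_iff)
  moreover have "det A > 0"
    using det_transition_matrix_pos[OF p] by (simp add: A det_real_matrix)
  ultimately have "det A = 1"
    by (simp add: pos_zmult_eq_1_iff)
  then show ?thesis
    using that A by (simp add: SL_int_def)
qed

text \<open>A tube of complete tori around \<open>\<Lambda>\<close> is connected, and the matrix is continuous and integral on
  it.\<close>

lemma transition_matrix_near_torus: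
  assumes torus: "liouville_torus \<A> F \<Lambda>" and sub: "\<Lambda> \<subseteq> U" "\<Lambda> \<subseteq> U'"
  obtains A W where "A \<in> SL_int" "open W" "\<Lambda> \<subseteq> W" "W \<subseteq> U \<inter> U'"
    "\<forall>p\<in>W. transition_matrix p = real_matrix A"
proof -
  obtain x where x: "x \<in> V" "\<Lambda> = {p \<in> U. I p = x}"
    using A.liouville_torus_is_fibre[OF torus sub(1)] .
  obtain x' where x': "x' \<in> V'" "\<Lambda> = {p \<in> U'. I' p = x'}"
    using B.liouville_torus_is_fibre[OF torus sub(2)] .
  define p0 where "p0 = A.torus_point x 0"
  have p0: "p0 \<in> \<Lambda>"
    unfolding x(2) p0_def using A.torus_point[OF x(1)] by simp
  have p0': "p0 \<in> U" "I p0 = x" "p0 \<in> U'" "I' p0 = x'"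
    using p0 x(2) x'(2) by auto
  have "{q \<in> U. I q = I p0} \<subseteq> U'" "{q \<in> U'. I' q = I' p0} \<subseteq> U"
    using sub x(2) x'(2) by (simp_all add: p0')
  from transition_matrix_SL[OF p0'(1,3) this]
  obtain A where A: "A \<in> SL_int" "transition_matrix p0 = real_matrix A" .
  have "open (U \<inter> U')"
    using A.open_U B.open_U by (rule open_Int)
  moreover have "{p \<in> U. I p = x} \<subseteq> U \<inter> U'"
    using sub x(2) by simp
  ultimately obtain r where r: "r > 0" "ball x r \<subseteq> V" "{p \<in> U. I p \<in> ball x r} \<subseteq> U \<inter> U'"
    by (rule A.fibre_neighbourhood[OF x(1)])
  define W where "W = {p \<in> U. I p \<in> ball x r}"
  have W: "W \<subseteq> U \<inter> U'"
    unfolding W_def by (rule r(3))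
  have p0W: "p0 \<in> W"
    using r(1) p0' by (simp add: W_def)
  have int: "transition_matrix p $ i $ j \<in> \<int>" if "p \<in> W" for p i j
  proof (rule transition_matrix_integral)
    show "p \<in> U"
      using that by (simp add: W_def)
    show "{q \<in> U. I q = I p} \<subseteq> U'"
      using that r(3) by (auto simp: W_def)
  qed
  have conn: "connected W"
    unfolding W_def using r(2) by (intro A.connected_tube) simp_all
  have const: "transition_matrix p $ i $ j = transition_matrix p0 $ i $ j" if "p \<in> W" for p i j
  proof -
    have "(\<lambda>p. transition_matrix p $ i $ j) constant_on W"
    proof (rule continuous_discrete_range_constant[OF conn])
      show "continuous_on W (\<lambda>p. transition_matrix p $ i $ j)"
        by (rule continuous_on_subset[OF continuous_on_transition_matrix W])
      fix p assume p: "p \<in> W"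
      have "1 \<le> norm (transition_matrix q $ i $ j - transition_matrix p $ i $ j)"
        if "q \<in> W" "transition_matrix q $ i $ j \<noteq> transition_matrix p $ i $ j" for q
        using Ints_nonzero_abs_ge1[OF Ints_diff[OF int[OF that(1)] int[OF p]]] that(2) by simp
      then show "\<exists>e>0. \<forall>q. q \<in> W \<and> transition_matrix q $ i $ j \<noteq> transition_matrix p $ i $ j \<longrightarrow>
          e \<le> norm (transition_matrix q $ i $ j - transition_matrix p $ i $ j)"
        by (intro exI[of _ 1]) simp
    qed
    then show ?thesis
      using that p0W unfolding constant_on_def by auto
  qed
  show ?thesis
  proof (rule that[OF A(1) _ _ W])
    have "open (U \<inter> I -` ball x r)"
      by (rule continuous_open_preimage[OF A.continuous_on_I A.open_U open_ball])
    then show "open W"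
      by (simp add: W_def vimage_def Int_def)
    show "\<Lambda> \<subseteq> W"
      using r(1) by (auto simp: x(2) W_def)
    show "\<forall>p\<in>W. transition_matrix p = real_matrix A"
      using const A(2) by (simp add: vec_eq_iff)
  qed
qed

text \<open>This is row \<open>h\<close> of the identity \<open>DG' = DG M\<close>.\<close>

lemma rotation_vector_change:
  assumes torus: "liouville_torus \<A> F \<Lambda>" and sub: "\<Lambda> \<subseteq> U" "\<Lambda> \<subseteq> U'" and p: "p \<in> \<Lambda>"
    and g: "\<And>p. p \<in> U \<Longrightarrow> F p $ h = g (I p)" and g': "\<And>p. p \<in> U' \<Longrightarrow> F p $ h = g' (I' p)"
  shows "rotation_vector g' I' \<Lambda> = transpose (transition_matrix p) *v rotation_vector g I \<Lambda>"
proof -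
  have "rotation_vector g I \<Lambda> = jacobian G (at (I p)) $ h"
    by (rule A.rotation_vector_row[OF torus sub(1) p g])
  moreover have "rotation_vector g' I' \<Lambda> = jacobian G' (at (I' p)) $ h"
    by (rule B.rotation_vector_row[OF torus sub(2) p g'])
  moreover have "jacobian G' (at (I' p)) = jacobian G (at (I p)) ** transition_matrix p"
    using jacobian_transition_matrix sub(1) p by auto
  ultimately show ?thesis
    by (simp add: vec_eq_iff matrix_matrix_mult_def vector_matrix_mult_def mult.commute)
qed

end

section \<open>Rotation numbers\<close>

lemma proj_class_image: "proj_class (real_matrix A *v w) = proj_action A (proj_class w)"
  unfolding proj_class_def proj_action_def image_def
  by (auto simp: matrix_vector_mult_scaleR)

lemma rbar_quotient_scale: "r \<noteq> 0 \<Longrightarrow> rbar_quotient (r * x) (r * y) = rbar_quotient x y"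
  by (simp add: rbar_quotient_def)

text \<open>A Moebius transformation is the action of its matrix in homogeneous coordinates \<open>[x : y]\<close>.\<close>

lemma moebius_rbar_quotient:
  assumes "x \<noteq> 0 \<or> y \<noteq> 0"
  shows "moebius_rbar p q r s (rbar_quotient x y) = rbar_quotient (p * x + q * y) (r * x + s * y)"
proof (cases "y = 0")
  case True
  then have "rbar_quotient x y = Infinity_Point"
    by (simp add: rbar_quotient_def)
  then show ?thesis
    using True assms rbar_quotient_scale[of x p r] by (simp add: mult.commute)
next
  case False
  have "rbar_quotient x y = Finite_Point (x / y)"
    using False by (simp add: rbar_quotient_def)
  moreover have "p * x + q * y = y * (p * (x / y) + q)" "r * x + s * y = y * (r * (x / y) + s)"
    using False by (simp_all add: field_simps)
  ultimately show ?thesis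
    using rbar_quotient_scale[OF False] by simp
qed

theorem lemma2p2:
  fixes \<A> :: "('m::{t2_space,second_countable_topology}, 'e::euclidean_space) chart set"
    and \<omega> :: "('m, 'e) two_form"
    and F :: "'m \<Rightarrow> real^'n"
    and h :: 'n
    and \<Lambda> U U' :: "'m set"
    and I I' :: "'m \<Rightarrow> real^'n"
    and g g' :: "real^'n \<Rightarrow> real"
  assumes "symplectic_manifold \<A> \<omega>"
    and "DIM('e) = 2 * CARD('n)"
    and "completely_integrable \<A> \<omega> F"
    and "proper_map euclidean euclidean F"
    and "liouville_torus \<A> F \<Lambda>"
    and "oriented_action_variables \<A> \<omega> F \<Lambda> U I"
    and "\<forall>p\<in>U. F p $ h = g (I p)"
    and "oriented_action_variables \<A> \<omega> F \<Lambda> U' I'"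
    and "\<forall>p\<in>U'. F p $ h = g' (I' p)"
  shows "\<exists>A \<in> SL_int. \<exists>W. open W \<and> \<Lambda> \<subseteq> W \<and> W \<subseteq> U \<inter> U' \<and>
     (\<forall>c\<in>\<A>. \<forall>p \<in> W \<inter> fst c. \<forall>v.
        differential c I p v = real_matrix A *v differential c I' p v) \<and>
     (\<forall>\<Lambda>'. liouville_torus \<A> F \<Lambda>' \<and> \<Lambda>' \<subseteq> W \<longrightarrow>
        rotation_number g I \<Lambda>' \<in> real_projective_space \<and>
        rotation_number g' I' \<Lambda>' = proj_action (transpose A) (rotation_number g I \<Lambda>') \<and>
        (\<forall>i. i \<noteq> h \<and> UNIV = {i, h} \<longrightarrow>
           rotation_quotient i h g' I' \<Lambda>' =
           moebius_rbar (of_int (A $ i $ i)) (of_int (A $ h $ i)) (of_int (A $ i $ h)) (of_int (A $ h $ h))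
             (rotation_quotient i h g I \<Lambda>')))"
proof -
  have manifold: "smooth_manifold \<A>"
    using assms(1) by (simp add: symplectic_manifold_def)
  obtain V \<theta> G where "action_angle_coordinates \<A> \<omega> U V I \<theta>" "local_diffeo_on V G"
    "\<forall>p\<in>U. F p = G (I p)" "\<forall>x\<in>V. det (jacobian G (at x)) > 0"
    using assms(6) unfolding oriented_action_variables_def by (elim conjE exE)
  with manifold interpret A: action_angle_system \<A> \<omega> F U V I \<theta> G
    by unfold_locales simp_all
  obtain V' \<theta>' G' where "action_angle_coordinates \<A> \<omega> U' V' I' \<theta>'" "local_diffeo_on V' G'"
    "\<forall>p\<in>U'. F p = G' (I' p)" "\<forall>x\<in>V'. det (jacobian G' (at x)) > 0"
    using assms(8) unfolding oriented_action_variables_def by (elim conjE exE)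
  with manifold interpret B: action_angle_system \<A> \<omega> F U' V' I' \<theta>' G'
    by unfold_locales simp_all
  interpret two_action_angle_systems \<A> \<omega> F U V I \<theta> G U' V' I' \<theta>' G' ..
  have "\<Lambda> \<subseteq> U" "\<Lambda> \<subseteq> U'"
    using assms(6,8) by (simp_all add: oriented_action_variables_def)
  from transition_matrix_near_torus[OF assms(5) this]
  obtain A W where A: "A \<in> SL_int" and W: "open W" "\<Lambda> \<subseteq> W" "W \<subseteq> U \<inter> U'"
    and M: "\<forall>p\<in>W. transition_matrix p = real_matrix A" .
  have g: "\<And>p. p \<in> U \<Longrightarrow> F p $ h = g (I p)" and g': "\<And>p. p \<in> U' \<Longrightarrow> F p $ h = g' (I' p)"
    using assms(7,9) by simp_all
  show ?thesis
  proof (intro bexI[OF _ A] exI[of _ W] conjI W ballI allI impI)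
    fix c p v assume "c \<in> \<A>" "p \<in> W \<inter> fst c"
    then show "differential c I p v = real_matrix A *v differential c I' p v"
      using differential_transition_matrix[of c p v] M W(3) by auto
  next
    fix \<Lambda>' assume \<Lambda>': "liouville_torus \<A> F \<Lambda>' \<and> \<Lambda>' \<subseteq> W"
    then have sub: "\<Lambda>' \<subseteq> U" "\<Lambda>' \<subseteq> U'" and torus: "liouville_torus \<A> F \<Lambda>'"
      using W(3) by auto
    have nz: "rotation_vector g I \<Lambda>' \<noteq> 0"
      by (rule A.rotation_vector_nonzero[OF torus sub(1) g])
    then show "rotation_number g I \<Lambda>' \<in> real_projective_space"
      unfolding rotation_number_def real_projective_space_def by blast
    obtain p where p: "p \<in> \<Lambda>'"
      using torus in_components_nonempty unfolding liouville_torus_def by blast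
    have w': "rotation_vector g' I' \<Lambda>' = real_matrix (transpose A) *v rotation_vector g I \<Lambda>'"
      using rotation_vector_change[OF torus sub p g g'] M \<Lambda>' p by (auto simp: transpose_real_matrix)
    then show "rotation_number g' I' \<Lambda>' = proj_action (transpose A) (rotation_number g I \<Lambda>')"
      by (simp add: rotation_number_def proj_class_image)
    fix i assume i: "i \<noteq> h \<and> UNIV = {i, h}"
    let ?w = "rotation_vector g I \<Lambda>'"
    have two: "j = i \<or> j = h" for j
      using UNIV_I[of j] unfolding conjunct2[OF i] by simp
    have sum_two: "(\<Sum>k\<in>UNIV. f k) = f i + f h" for f :: "'n \<Rightarrow> real"
      unfolding conjunct2[OF i] using conjunct1[OF i] by simp
    have "?w $ i \<noteq> 0 \<or> ?w $ h \<noteq> 0"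
    proof (rule ccontr)
      assume "\<not> (?w $ i \<noteq> 0 \<or> ?w $ h \<noteq> 0)"
      then have "?w $ j = 0" for j
        using two[of j] by auto
      then show False
        using nz by (simp add: vec_eq_iff)
    qed
    moreover have "rotation_vector g' I' \<Lambda>' $ j = of_int (A $ i $ j) * ?w $ i + of_int (A $ h $ j) * ?w $ h" for j
      by (simp add: w' matrix_vector_mult_def transpose_def sum_two)
    ultimately show "rotation_quotient i h g' I' \<Lambda>' =
        moebius_rbar (of_int (A $ i $ i)) (of_int (A $ h $ i)) (of_int (A $ i $ h)) (of_int (A $ h $ h))
          (rotation_quotient i h g I \<Lambda>')"
      by (simp add: rotation_quotient_def moebius_rbar_quotient)
  qed
qed

end
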